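(* Let $r\ge 2$ and $k\ge 1$ be fixed integers. If $k\ge r+1$, then, as $n\to\infty$, $$n\left(\frac1r-\frac{1}{r k^{1/r}}\right)(1+o_n(1))\ \ge\ f(n,k,r)\ \ge\ n\left(\frac1r-\frac{z_{k,r}}{r}\right)(1+o_n(1)).$$ If $k\le r$, then $z_{k,r}=1$, and $f(n,k,r)=1$ for every $n\ge r$ with $k\le\binom nr$.
   Context: $K_n^r$ denotes the complete $r$-uniform hypergraph on $n$ vertices. For a $k$-edge coloring $c:E(K_n^r)\to\{1,\ldots,k\}$ (an arbitrary map), let $f(K_n^r,c)$ be the minimum, over the colors $i\in\{1,\ldots,k\}$, of the number of connected components of the subhypergraph induced by the edges of color $i$; this subhypergraph consists of the edges of color $i$ and the vertices contained in them, so isolated vertices are not counted as components (an unused color has $0$ components). $f(n,k,r)$ is the maximum of $f(K_n^r,c)$ over all $k$-edge colorings $c$ of $K_n^r$; it is always assumed that $k\le\binom nr$. Given an edge-coloring $c$ of $K_n^r$, let $z(n,r,c,s)$ be the fraction of the $n$ vertices that are incident with at least one edge of color $s$, and let $z(n,r,c)$ be the maximum of $z(n,r,c,s)$ over all colors $s$ appearing in $c$. Let $z_k(n,r)$ be the minimum of $z(n,r,c)$ over all edge-colorings $c$ of $K_n^r$ that use at most $k$ colors, and let $z_{k,r}=\inf_{n\ge r} z_k(n,r)$. Here $o_n(1)$ denotes a quantity tending to $0$ as $n\to\infty$ with $k,r$ fixed (possibly a different quantity on each side). *)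

theory Defs
  imports Complex_Main "HOL-Library.FuncSet"
begin

text \<open>A hypergraph without isolated vertices is represented by its set of edges \<open>H\<close>;
  its vertex set is then \<open>\<Union>H\<close>.\<close>

definition edge_adjacency :: "'a set set \<Rightarrow> ('a \<times> 'a) set" where
  "edge_adjacency H = {(u, v). \<exists>e\<in>H. u \<in> e \<and> v \<in> e}"

definition edge_components :: "'a set set \<Rightarrow> 'a set set" where
  "edge_components H = \<Union>H // (edge_adjacency H)\<^sup>*"

definition complete_edges :: "nat \<Rightarrow> nat \<Rightarrow> nat set set" where
  "complete_edges n r = {e. e \<subseteq> {..<n} \<and> card e = r}"

definition color_class :: "nat \<Rightarrow> nat \<Rightarrow> (nat set \<Rightarrow> nat) \<Rightarrow> nat \<Rightarrow> nat set set" where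
  "color_class n r c i = {e \<in> complete_edges n r. c e = i}"

definition edge_colorings :: "nat \<Rightarrow> nat \<Rightarrow> nat \<Rightarrow> (nat set \<Rightarrow> nat) set" where
  "edge_colorings n k r = complete_edges n r \<rightarrow> {1..k}"

definition f_coloring :: "nat \<Rightarrow> nat \<Rightarrow> nat \<Rightarrow> (nat set \<Rightarrow> nat) \<Rightarrow> nat" where
  "f_coloring n k r c = Min ((\<lambda>i. card (edge_components (color_class n r c i))) ` {1..k})"

definition f_max :: "nat \<Rightarrow> nat \<Rightarrow> nat \<Rightarrow> nat" where
  "f_max n k r = Max (f_coloring n k r ` edge_colorings n k r)"

definition z_color :: "nat \<Rightarrow> nat \<Rightarrow> (nat set \<Rightarrow> nat) \<Rightarrow> nat \<Rightarrow> real" where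
  "z_color n r c s = real (card (\<Union>(color_class n r c s))) / real n"

definition z_coloring :: "nat \<Rightarrow> nat \<Rightarrow> (nat set \<Rightarrow> nat) \<Rightarrow> real" where
  "z_coloring n r c = Max (z_color n r c ` c ` complete_edges n r)"

definition z_min :: "nat \<Rightarrow> nat \<Rightarrow> nat \<Rightarrow> real" where
  "z_min k n r = Min (z_coloring n r ` {c. card (c ` complete_edges n r) \<le> k})"

definition z_inf :: "nat \<Rightarrow> nat \<Rightarrow> real" where
  "z_inf k r = (INF n\<in>{r..}. z_min k n r)"

text \<open>The extrema above are taken over finite nonempty sets, and the infimum over a set
  that is bounded below, so \<open>Min\<close>, \<open>Max\<close> and \<open>INF\<close> have their intended meaning.\<close>

lemma finite_complete_edges: "finite (complete_edges n r)"
  unfolding complete_edges_def by (rule finite_subset[of _ "Pow {..<n}"]) auto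

lemma complete_edges_nonempty: "r \<le> n \<Longrightarrow> complete_edges n r \<noteq> {}"
  unfolding complete_edges_def by (auto intro!: exI[of _ "{..<r}"])

lemma Union_color_class: "\<Union>(color_class n r c i) \<subseteq> {..<n}"
  unfolding color_class_def complete_edges_def by auto

lemma card_Union_color_class: "card (\<Union>(color_class n r c i)) \<le> n"
  using card_mono[OF finite_lessThan Union_color_class] by simp

lemma card_components_color_class: "card (edge_components (color_class n r c i)) \<le> n"
proof -
  let ?H = "color_class n r c i"
  have "edge_components ?H = (\<lambda>x. (edge_adjacency ?H)\<^sup>* `` {x}) ` \<Union>?H"
    unfolding edge_components_def quotient_def by auto
  then have "card (edge_components ?H) \<le> card (\<Union>?H)"
    using card_image_le[OF finite_subset[OF Union_color_class finite_lessThan]] by simp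
  then show ?thesis
    using card_Union_color_class[of n r c i] by linarith
qed

lemma finite_f_coloring:
  assumes "k \<ge> 1"
  shows "finite (f_coloring n k r ` edge_colorings n k r)"
proof (rule finite_subset)
  show "f_coloring n k r ` edge_colorings n k r \<subseteq> {..n}"
  proof clarsimp
    fix c
    have "f_coloring n k r c \<in> (\<lambda>i. card (edge_components (color_class n r c i))) ` {1..k}"
      unfolding f_coloring_def by (rule Min_in) (use assms in auto)
    then show "f_coloring n k r c \<le> n"
      using card_components_color_class by auto
  qed
qed simp

lemma edge_colorings_nonempty: "k \<ge> 1 \<Longrightarrow> edge_colorings n k r \<noteq> {}"
  unfolding edge_colorings_def by (auto simp: Pi_def intro!: exI[of _ "\<lambda>_. 1"])

lemma z_coloring_in:
  assumes "r \<le> n"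
  shows "z_coloring n r c \<in> (\<lambda>j. real j / real n) ` {..n}"
proof -
  have "z_coloring n r c \<in> z_color n r c ` c ` complete_edges n r"
    unfolding z_coloring_def
    by (rule Max_in) (use assms finite_complete_edges complete_edges_nonempty in auto)
  then show ?thesis
    using card_Union_color_class by (auto simp: z_color_def)
qed

lemma finite_z_coloring: "r \<le> n \<Longrightarrow> finite (z_coloring n r ` C)"
  by (rule finite_subset[of _ "(\<lambda>j. real j / real n) ` {..n}"]) (use z_coloring_in in auto)

lemma few_color_colorings_nonempty:
  "k \<ge> 1 \<Longrightarrow> {c :: nat set \<Rightarrow> nat. card (c ` complete_edges n r) \<le> k} \<noteq> {}"
  by (auto simp: image_constant_conv intro!: exI[of _ "\<lambda>_. 1"])

lemma bdd_below_z_min: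
  assumes "k \<ge> 1"
  shows "bdd_below ((\<lambda>n. z_min k n r) ` {r..})"
proof (rule bdd_belowI2[where m = 0])
  fix n assume "n \<in> {r..}"
  then have n: "r \<le> n" by simp
  have "z_min k n r \<in> z_coloring n r ` {c. card (c ` complete_edges n r) \<le> k}"
    unfolding z_min_def
    by (rule Min_in) (use finite_z_coloring[OF n] few_color_colorings_nonempty[OF assms] in auto)
  then show "0 \<le> z_min k n r"
    using z_coloring_in[OF n] by (metis (no_types, lifting) imageE divide_nonneg_nonneg of_nat_0_le_iff)
qed

end

theory Submission
  imports Defs "HOL-Library.Disjoint_Sets"
begin

text \<open>
  All three parts are elementary counting arguments.

  Upper bound. Some color has at least a fraction \<open>1/k\<close> of all edges. Because the binomial
  coefficient is convex, a hypergraph with \<open>m\<close> components has the most edges when all components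
  but one are single edges; then the large component has \<open>n - r(m - 1)\<close> vertices
  (\<open>card_edges_le\<close>). Hence \<open>(n - r m)\<^sup>r\<close> is asymptotically at least \<open>n\<^sup>r / k\<close>, that is,
  \<open>m\<close> is at most about \<open>n (1 - 1 / root r k) / r\<close>.

  Lower bound. If every color leaves a set of about \<open>(1 - z) n\<close> vertices untouched, then inside
  each of these sets one can recolor a nearly perfect matching with the missing color; every edge
  of that matching becomes a component of its own. The matchings only have to be edge-disjoint,
  which a greedy choice achieves because \<open>k - 1\<close> matchings have degree at most \<open>k - 1\<close>
  (\<open>disjoint_matchings\<close>, \<open>recoloring_le_f_max\<close>). Colorings in which every color touches about
  \<open>z n\<close> vertices exist for all large \<open>n\<close>, not only for those \<open>n\<close> at which the infimum is
  nearly attained, since a coloring can be blown up by replacing each vertex by a cluster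
  (\<open>blow_up_coloring\<close>).

  At most \<open>r\<close> colors. If every color missed a vertex, an edge through one missed vertex of each
  color could have no color; so \<open>z = 1\<close> (\<open>spanning_color\<close>). If every color had two components,
  each color would respect a bipartition of the vertex set, and an edge crossing all \<open>k\<close>
  bipartitions could have no color; such an edge exists because \<open>max 2 k\<close> vertices suffice to
  cross \<open>k\<close> bipartitions (\<open>small_splitting_set\<close>).
\<close>

section \<open>Components of a hypergraph\<close>

lemma equiv_edge_adjacency: "equiv UNIV ((edge_adjacency H)\<^sup>*)"
proof (rule equivI)
  have "sym (edge_adjacency H)"
    unfolding edge_adjacency_def sym_def by auto
  then show "sym ((edge_adjacency H)\<^sup>*)" by (rule sym_rtrancl)
qed (auto simp: refl_rtrancl trans_rtrancl)

lemma edge_componentsE: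
  assumes "C \<in> edge_components H"
  obtains x where "x \<in> \<Union>H" "C = (edge_adjacency H)\<^sup>* `` {x}"
  using assms unfolding edge_components_def by (rule quotientE) (rule that)

lemma edge_subset_component:
  assumes "C \<in> edge_components H" "e \<in> H" "u \<in> e" "u \<in> C"
  shows "e \<subseteq> C"
proof
  fix v assume "v \<in> e"
  then have "(u, v) \<in> edge_adjacency H"
    using assms unfolding edge_adjacency_def by auto
  moreover obtain x where "C = (edge_adjacency H)\<^sup>* `` {x}"
    using assms(1) by (rule edge_componentsE)
  ultimately show "v \<in> C"
    using \<open>u \<in> C\<close> by (auto intro: rtrancl_into_rtrancl)
qed

lemma closed_set_reachable:
  assumes "(x, y) \<in> (edge_adjacency H)\<^sup>*" "x \<in> A"
    and "\<And>e. e \<in> H \<Longrightarrow> e \<inter> A \<noteq> {} \<Longrightarrow> e \<subseteq> A"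
  shows "y \<in> A"
  using assms(1,2)
proof (induction rule: rtrancl_induct)
  case (step y z)
  then show ?case using assms(3) unfolding edge_adjacency_def by blast
qed

lemma Union_edge_components: "\<Union>(edge_components H) = \<Union>H"
proof
  show "\<Union>(edge_components H) \<subseteq> \<Union>H"
  proof
    fix y assume "y \<in> \<Union>(edge_components H)"
    then obtain x where "x \<in> \<Union>H" "(x, y) \<in> (edge_adjacency H)\<^sup>*"
      unfolding edge_components_def quotient_def by blast
    then show "y \<in> \<Union>H"
      by (intro closed_set_reachable[of x y H "\<Union>H"]) auto
  qed
  show "\<Union>H \<subseteq> \<Union>(edge_components H)"
    unfolding edge_components_def quotient_def by blast
qed

lemma edge_components_disjoint:
  assumes "C \<in> edge_components H" "D \<in> edge_components H" "C \<noteq> D"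
  shows "C \<inter> D = {}"
proof -
  have "C \<in> UNIV // (edge_adjacency H)\<^sup>*" "D \<in> UNIV // (edge_adjacency H)\<^sup>*"
    using assms(1,2) unfolding edge_components_def quotient_def by auto
  from quotient_disj[OF equiv_edge_adjacency this] show ?thesis
    using assms(3) by blast
qed

lemma edge_components_contains_edge:
  assumes "C \<in> edge_components H"
  obtains e where "e \<in> H" "e \<noteq> {}" "e \<subseteq> C"
proof -
  obtain x where x: "x \<in> \<Union>H" "C = (edge_adjacency H)\<^sup>* `` {x}"
    using assms by (rule edge_componentsE)
  then obtain e where e: "e \<in> H" "x \<in> e" by auto
  have "x \<in> C" using x by auto
  then show ?thesis
    using that[of e] e edge_subset_component[OF assms e(1,2)] by auto
qed

text \<open>The recolored matching edges of the lower bound are counted as components through this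
  criterion.\<close>

lemma isolated_edge_is_component:
  assumes "e \<in> H" "e \<noteq> {}"
    and "\<And>e'. e' \<in> H \<Longrightarrow> e' \<inter> e \<noteq> {} \<Longrightarrow> e' = e"
  shows "e \<in> edge_components H"
proof -
  obtain x where x: "x \<in> e" using assms(2) by auto
  have "x \<in> \<Union>(edge_components H)"
    unfolding Union_edge_components using x assms(1) by blast
  then obtain C where C: "C \<in> edge_components H" "x \<in> C" by auto
  have 1: "e \<subseteq> C" by (rule edge_subset_component[OF C(1) assms(1) x C(2)])
  obtain y where y: "C = (edge_adjacency H)\<^sup>* `` {y}"
    using C(1) by (rule edge_componentsE)
  have eq: "C = (edge_adjacency H)\<^sup>* `` {x}"
    using equiv_class_eq[OF equiv_edge_adjacency, of y x H] C(2) y by auto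
  have "C \<subseteq> e"
    using closed_set_reachable[of x _ H e] x assms(3) unfolding eq by blast
  with 1 C(1) show ?thesis by auto
qed

lemma finite_edge_components:
  assumes "finite (\<Union>H)" shows "finite (edge_components H)"
  using assms Union_edge_components[of H] by (metis finite_UnionD)

lemma sum_card_edge_components:
  assumes "finite (\<Union>H)"
  shows "(\<Sum>C\<in>edge_components H. card C) = card (\<Union>H)"
proof -
  have "card (\<Union>(edge_components H)) = (\<Sum>C\<in>edge_components H. card C)"
  proof (rule card_Union_disjoint)
    show "disjoint (edge_components H)"
      using edge_components_disjoint by (auto simp: pairwise_def disjnt_def)
    show "finite C" if "C \<in> edge_components H" for C
      using that Union_edge_components[of H] assms by (metis Sup_upper finite_subset)
  qed
  then show ?thesis using Union_edge_components[of H] by simp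
qed

section \<open>Few components force few edges\<close>

text \<open>Convexity of the binomial coefficient: moving \<open>q\<close> vertices from a component with
  \<open>r + q\<close> vertices to another one does not decrease the possible number of edges, because each
  moved vertex contributes \<open>x choose (r - 1)\<close> edges with \<open>x\<close> the size of what it joins.\<close>

lemma binomial_add_le:
  assumes "r \<ge> 1"
  shows "((r + p) choose r) + ((r + q) choose r) \<le> ((r + p + q) choose r) + 1"
proof (induction q)
  case (Suc q)
  obtain s where s: "r = Suc s" using assms by (cases r) auto
  have "(r + Suc q) choose r = ((r + q) choose r) + ((r + q) choose s)"
    unfolding s by simp
  moreover have "(r + p + Suc q) choose r = ((r + p + q) choose r) + ((r + p + q) choose s)"
    unfolding s by simp
  moreover have "(r + q) choose s \<le> (r + p + q) choose s"
    by (rule binomial_right_mono) auto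
  ultimately show ?case using Suc by linarith
qed simp

text \<open>Repeated shifting turns all components but one into sets of size \<open>r\<close>, which carry one
  edge each.\<close>

lemma sum_binomial_le:
  assumes "finite I" "I \<noteq> {}" "r \<ge> 1" "\<And>j. j \<in> I \<Longrightarrow> r \<le> a j"
  shows "r * card I \<le> sum a I \<and>
    (\<Sum>j\<in>I. a j choose r) \<le> ((sum a I - r * (card I - 1)) choose r) + (card I - 1)"
  using assms(1,2,4)
proof (induction rule: finite_ne_induct)
  case (insert x F)
  define h where "h = card F"
  have h: "h \<ge> 1" using insert.hyps by (simp add: h_def Suc_leI card_gt_0_iff)
  have IH: "r * h \<le> sum a F"
    "(\<Sum>j\<in>F. a j choose r) \<le> ((sum a F - r * (h - 1)) choose r) + (h - 1)"
    using insert.IH insert.prems unfolding h_def by auto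
  obtain p where p: "a x = r + p" using insert.prems[of x] le_Suc_ex by auto
  obtain q where q: "sum a F = r * h + q" using IH(1) le_Suc_ex by blast
  obtain g where g: "h = Suc g" using h by (cases h) auto
  have 1: "sum a F - r * (h - 1) = r + q" using q g by (simp add: algebra_simps)
  have 2: "sum a (insert x F) - r * (card (insert x F) - 1) = r + p + q"
    using insert.hyps p q by (simp add: h_def[symmetric])
  have "(\<Sum>j\<in>insert x F. a j choose r) \<le> ((r + p) choose r) + ((r + q) choose r) + g"
    using insert.hyps IH(2) 1 p g by simp
  also have "\<dots> \<le> ((r + p + q) choose r) + Suc g"
    using binomial_add_le[OF assms(3), of p q] by simp
  finally have "(\<Sum>j\<in>insert x F. a j choose r) \<le>
    ((sum a (insert x F) - r * (card (insert x F) - 1)) choose r) + (card (insert x F) - 1)"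
    using 2 insert.hyps g h_def by simp
  moreover have "r * card (insert x F) \<le> sum a (insert x F)"
    using insert.hyps p q by (simp add: h_def[symmetric])
  ultimately show ?case by blast
qed simp

text \<open>The bound is stated for every \<open>m\<close> up to the number of components since it is applied
  with the minimum over all colors. The summand \<open>card V\<close> is a crude bound for the number of
  single-edge components; as \<open>r \<ge> 2\<close> in the application, it is of lower order than the number
  of all edges.\<close>

lemma card_edges_le:
  assumes "finite V" "\<Union>H \<subseteq> V" "\<And>e. e \<in> H \<Longrightarrow> card e = r" "r \<ge> 1"
    and m: "1 \<le> m" "m \<le> card (edge_components H)"
  shows "r * m \<le> card V \<and> card H \<le> ((card V - r * (m - 1)) choose r) + card V"
proof -
  let ?K = "edge_components H"
  define h where "h = card ?K"
  have finU: "finite (\<Union>H)" using assms(1,2) by (rule finite_subset[rotated])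
  have fin: "finite ?K" using finU by (rule finite_edge_components)
  have ne: "?K \<noteq> {}" using m by auto
  have finC: "finite C" if "C \<in> ?K" for C
    using that Union_edge_components[of H] finU by (metis Sup_upper finite_subset)
  have ge: "r \<le> card C" if C: "C \<in> ?K" for C
  proof -
    obtain e where "e \<in> H" "e \<subseteq> C" using C by (rule edge_components_contains_edge)
    then show ?thesis using card_mono[OF finC[OF C]] assms(3) by metis
  qed
  have S: "(\<Sum>C\<in>?K. card C) \<le> card V"
    using sum_card_edge_components[OF finU] card_mono[OF assms(1,2)] by simp
  have bound: "r * h \<le> (\<Sum>C\<in>?K. card C)" "(\<Sum>C\<in>?K. card C choose r)
      \<le> (((\<Sum>C\<in>?K. card C) - r * (h - 1)) choose r) + (h - 1)"
    using sum_binomial_le[OF fin ne assms(4), of card] ge unfolding h_def by blast+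
  have "H \<subseteq> (\<Union>C\<in>?K. {e. e \<subseteq> C \<and> card e = r})"
  proof
    fix e assume e: "e \<in> H"
    then have "e \<noteq> {}" using assms(3,4) by fastforce
    then obtain x where x: "x \<in> e" by auto
    then obtain C where C: "C \<in> ?K" "x \<in> C" using e Union_edge_components[of H] by blast
    then show "e \<in> (\<Union>C\<in>?K. {e. e \<subseteq> C \<and> card e = r})"
      using edge_subset_component[OF C(1) e x C(2)] assms(3)[OF e] by auto
  qed
  moreover have "finite (\<Union>C\<in>?K. {e. e \<subseteq> C \<and> card e = r})"
    using fin finC by auto
  ultimately have "card H \<le> card (\<Union>C\<in>?K. {e. e \<subseteq> C \<and> card e = r})"
    by (simp add: card_mono)
  also have "\<dots> \<le> (\<Sum>C\<in>?K. card {e. e \<subseteq> C \<and> card e = r})"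
    by (rule card_UN_le[OF fin])
  also have "\<dots> = (\<Sum>C\<in>?K. card C choose r)"
    by (rule sum.cong) (auto simp: n_subsets finC)
  also have "\<dots> \<le> (((\<Sum>C\<in>?K. card C) - r * (h - 1)) choose r) + (h - 1)"
    by (rule bound(2))
  also have "\<dots> \<le> ((card V - r * (m - 1)) choose r) + card V"
  proof (rule add_mono)
    have "r * (m - 1) \<le> r * (h - 1)" using m unfolding h_def by (intro mult_le_mono2 diff_le_mono)
    then show "(((\<Sum>C\<in>?K. card C) - r * (h - 1)) choose r) \<le> ((card V - r * (m - 1)) choose r)"
      using S by (intro binomial_right_mono) linarith
    have "h \<le> r * h" using assms(4) by simp
    also have "\<dots> \<le> card V"
      using bound(1) S by simp
    finally show "h - 1 \<le> card V" by simp
  qed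
  finally have 1: "card H \<le> ((card V - r * (m - 1)) choose r) + card V" .
  have "r * m \<le> r * h" using m h_def by simp
  also have "\<dots> \<le> card V"
    using bound(1) S by simp
  finally show ?thesis using 1 by blast
qed

section \<open>The upper bound\<close>

lemma card_complete_edges: "card (complete_edges n r) = n choose r"
  unfolding complete_edges_def using n_subsets[of "{..<n}" r] by simp

lemma f_coloring_le:
  assumes "i \<in> {1..k}"
  shows "f_coloring n k r c \<le> card (edge_components (color_class n r c i))"
  unfolding f_coloring_def using assms by (intro Min_le) auto

lemma f_coloring_geI:
  assumes "k \<ge> 1" "\<And>i. i \<in> {1..k} \<Longrightarrow> t \<le> card (edge_components (color_class n r c i))"
  shows "t \<le> f_coloring n k r c"
  unfolding f_coloring_def using assms by (subst Min_ge_iff) auto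

lemma f_max_attained:
  assumes "k \<ge> 1"
  obtains c where "c \<in> edge_colorings n k r" "f_max n k r = f_coloring n k r c"
proof -
  have "f_max n k r \<in> f_coloring n k r ` edge_colorings n k r"
    unfolding f_max_def
    by (rule Max_in) (use assms finite_f_coloring edge_colorings_nonempty in auto)
  then show ?thesis using that by auto
qed

lemma f_coloring_le_f_max:
  assumes "k \<ge> 1" "c \<in> edge_colorings n k r"
  shows "f_coloring n k r c \<le> f_max n k r"
  unfolding f_max_def using assms finite_f_coloring by (intro Max_ge) auto

lemma popular_color:
  assumes "c \<in> edge_colorings n k r" "k \<ge> 1"
  obtains i where "i \<in> {1..k}" "n choose r \<le> k * card (color_class n r c i)"
proof (rule ccontr)
  note pick = that
  assume "\<not> thesis"
  then have less: "k * card (color_class n r c i) < n choose r" if "i \<in> {1..k}" for i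
    using pick[of i] that by linarith
  have "complete_edges n r = (\<Union>i\<in>{1..k}. color_class n r c i)"
    using assms(1) unfolding edge_colorings_def color_class_def by auto
  then have "n choose r \<le> (\<Sum>i\<in>{1..k}. card (color_class n r c i))"
    using card_UN_le[of "{1..k}" "color_class n r c"] card_complete_edges[of n r] by simp
  then have "k * (n choose r) \<le> (\<Sum>i\<in>{1..k}. k * card (color_class n r c i))"
    by (simp add: sum_distrib_left[symmetric])
  also have "\<dots> < (\<Sum>i\<in>{1..k}. n choose r)"
    by (rule sum_strict_mono) (use assms less in auto)
  finally show False by simp
qed

lemma binomial_le_f_max:
  assumes "k \<ge> 1" "r \<ge> 1" "f_max n k r \<ge> 1"
  shows "r * f_max n k r \<le> n \<and>
    n choose r \<le> k * (((n - r * (f_max n k r - 1)) choose r) + n)"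
proof -
  obtain c where c: "c \<in> edge_colorings n k r" "f_max n k r = f_coloring n k r c"
    using assms(1) by (rule f_max_attained)
  obtain i where i: "i \<in> {1..k}" "n choose r \<le> k * card (color_class n r c i)"
    using c(1) assms(1) by (rule popular_color)
  have "f_max n k r \<le> card (edge_components (color_class n r c i))"
    using f_coloring_le[OF i(1)] c(2) by simp
  from card_edges_le[OF finite_lessThan Union_color_class _ assms(2,3) this]
  have "r * f_max n k r \<le> n"
    "card (color_class n r c i) \<le> ((n - r * (f_max n k r - 1)) choose r) + n"
    by (auto simp: color_class_def complete_edges_def)
  then show ?thesis using i(2) by (meson le_trans mult_le_mono2)
qed

lemma power_le_fact_binomial:
  assumes "r \<le> n"
  shows "(real n - real r) ^ r \<le> fact r * real (n choose r)"
proof -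
  have "(real n - real r) ^ r = (\<Prod>i=0..<r. real n - real r)" by simp
  also have "\<dots> \<le> (\<Prod>i=0..<r. real n - real i)"
    by (rule prod_mono) (use assms in auto)
  also have "\<dots> = fact r * real (n choose r)"
    by (simp add: gbinomial_mult_fact binomial_gbinomial)
  finally show ?thesis .
qed

text \<open>The estimate for \<open>x = n - r (m - 1)\<close>, where \<open>m\<close> is the extremal number of components,
  comes from \<open>(n - r)\<^sup>r \<le> r! (n choose r) \<le> k (x\<^sup>r + r! n)\<close>. After division by \<open>n\<^sup>r\<close> the
  error term \<open>r! n / n\<^sup>r\<close> is at most \<open>r! / n\<close>. The outer maximum only serves to cover
  \<open>m = 0\<close>.\<close>

lemma f_max_upper:
  assumes "k \<ge> 1" "r \<ge> 2" "n \<ge> r"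
  shows "real (f_max n k r) \<le> real n * max 0 (1 / real n +
    (1 - root r ((1 - real r / real n) ^ r / real k - fact r / real n)) / real r)"
proof (cases "f_max n k r \<ge> 1")
  case False
  then have "real (f_max n k r) = 0" by simp
  then show ?thesis by (simp add: mult_nonneg_nonneg)
next
  case True
  define m where "m = f_max n k r"
  define x where "x = real n - real r * (real m - 1)"
  define y where "y = (1 - real r / real n) ^ r / real k - fact r / real n"
  have n: "n > 0" using assms by auto
  have m: "m \<ge> 1" "r * m \<le> n" "n choose r \<le> k * (((n - r * (m - 1)) choose r) + n)"
    using binomial_le_f_max[OF assms(1) _ True] assms(2) True unfolding m_def by auto
  have "r * (m - 1) \<le> r * m" by simp
  then have le: "r * (m - 1) \<le> n" using m(2) by linarith
  have x: "x = real (n - r * (m - 1))"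
    using le m(1) unfolding x_def by (simp add: of_nat_diff)
  then have x0: "x \<ge> 0" by simp
  have "((n - r * (m - 1)) choose r) * fact r \<le> (n - r * (m - 1)) ^ r"
    by (rule binomial_fact_pow)
  then have up: "fact r * real ((n - r * (m - 1)) choose r) \<le> x ^ r"
    unfolding x by (metis (mono_tags, lifting) mult.commute of_nat_fact of_nat_le_iff of_nat_mult of_nat_power)
  have "(real n - real r) ^ r \<le> fact r * real (n choose r)"
    by (rule power_le_fact_binomial[OF assms(3)])
  also have "\<dots> \<le> fact r * real (k * (((n - r * (m - 1)) choose r) + n))"
    using m(3) by (intro mult_left_mono) (auto simp del: of_nat_mult of_nat_add)
  also have "\<dots> = real k * (fact r * real ((n - r * (m - 1)) choose r) + fact r * real n)"
    by (simp add: algebra_simps)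
  also have "\<dots> \<le> real k * (x ^ r + fact r * real n)"
    using up by (intro mult_left_mono) auto
  finally have "(real n - real r) ^ r \<le> real k * (x ^ r + fact r * real n)" .
  then have 1: "(real n - real r) ^ r / real k - fact r * real n \<le> x ^ r"
    using assms(1) by (simp add: field_simps)
  have "y = (real n - real r) ^ r / real n ^ r / real k - fact r * real n / real n ^ 2"
    using n unfolding y_def by (simp add: power_divide[symmetric] diff_divide_distrib power2_eq_square)
  also have "\<dots> \<le> (real n - real r) ^ r / real n ^ r / real k - fact r * real n / real n ^ r"
    using n assms(2) by (intro diff_left_mono divide_left_mono power_increasing) auto
  also have "\<dots> = ((real n - real r) ^ r / real k - fact r * real n) / real n ^ r"
    by (simp add: diff_divide_distrib)
  also have "\<dots> \<le> x ^ r / real n ^ r"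
    using 1 by (intro divide_right_mono) auto
  also have "\<dots> = (x / real n) ^ r" by (simp add: power_divide)
  finally have "root r y \<le> root r ((x / real n) ^ r)"
    using assms(2) by simp
  also have "\<dots> = x / real n"
    using assms(2) x0 by (intro real_root_power_cancel) auto
  finally have ry: "root r y \<le> x / real n" .
  have "real m = 1 + (real n - x) / real r"
    using assms(2) unfolding x_def by (simp add: field_simps)
  also have "\<dots> = real n * (1 / real n + (1 - x / real n) / real r)"
    using n assms(2) by (simp add: field_simps)
  also have "\<dots> \<le> real n * (1 / real n + (1 - root r y) / real r)"
    using ry by (intro mult_left_mono add_left_mono divide_right_mono) auto
  also have "\<dots> \<le> real n * max 0 (1 / real n + (1 - root r y) / real r)"
    by (intro mult_left_mono) auto
  finally show ?thesis unfolding m_def y_def .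
qed

lemma f_max_asymptotic_upper:
  assumes "k \<ge> 2" "r \<ge> 2"
  shows "\<exists>\<epsilon> :: nat \<Rightarrow> real. \<epsilon> \<longlonglongrightarrow> 0 \<and> (\<forall>\<^sub>F n in sequentially.
    real n * (1 / real r - 1 / (real r * root r (real k))) * (1 + \<epsilon> n) \<ge> real (f_max n k r))"
proof -
  define a where "a = 1 / real r - 1 / (real r * root r (real k))"
  define b where "b = (\<lambda>n. max 0 (1 / real n +
    (1 - root r ((1 - real r / real n) ^ r / real k - fact r / real n)) / real r))"
  have "1 < root r (real k)" using assms by (simp add: real_root_gt_1_iff)
  then have a: "a > 0" using assms unfolding a_def by (simp add: field_simps)
  have a': "a = 0 + (1 - root r ((1 - 0) ^ r / real k - 0)) / real r"
    using assms unfolding a_def by (simp add: real_root_divide diff_divide_distrib)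
  have "b \<longlonglongrightarrow> max 0 (0 + (1 - root r ((1 - 0) ^ r / real k - 0)) / real r)"
    unfolding b_def using assms
    by (intro tendsto_intros tendsto_divide_0[OF tendsto_const] filterlim_real_sequentially
        filterlim_at_top_imp_at_infinity) auto
  then have b: "b \<longlonglongrightarrow> a" using a a' by simp
  show ?thesis
  proof (intro exI[of _ "\<lambda>n. b n / a - 1"] conjI)
    show "(\<lambda>n. b n / a - 1) \<longlonglongrightarrow> 0"
      using tendsto_diff[OF tendsto_divide[OF b tendsto_const[of a]] tendsto_const[of 1]] a by simp
    show "\<forall>\<^sub>F n in sequentially. real n * (1 / real r - 1 / (real r * root r (real k))) *
      (1 + (b n / a - 1)) \<ge> real (f_max n k r)"
      using eventually_ge_at_top[of r]
    proof eventually_elim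
      case (elim n)
      then show ?case
        using f_max_upper[of k r n] assms a unfolding a_def[symmetric] b_def by simp
    qed
  qed
qed

section \<open>Edge-disjoint matchings\<close>

text \<open>The \<open>r\<close>-sets that extend a fixed \<open>(r - 1)\<close>-set all contain a common vertex, so fewer
  than \<open>k\<close> of them are forbidden, while there are at least \<open>k\<close> of them.\<close>

lemma edge_avoiding:
  assumes "finite W" "r \<ge> 2" "card W \<ge> r + k"
    and F: "\<And>v. v \<in> W \<Longrightarrow> finite {e \<in> F. v \<in> e} \<and> card {e \<in> F. v \<in> e} < k"
  obtains e where "e \<subseteq> W" "card e = r" "e \<notin> F"
proof -
  have "r - 1 \<le> card W" using assms(3) by simp
  then obtain S where S: "S \<subseteq> W" "card S = r - 1" by (rule obtain_subset_with_card_n)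
  have finS: "finite S" using S(1) assms(1) by (rule finite_subset)
  have "S \<noteq> {}" using S(2) assms(2) by auto
  then obtain v where v: "v \<in> S" by auto
  have inj: "inj_on (\<lambda>x. insert x S) (W - S)" by (auto simp: inj_on_def)
  have "card (W - S) = card W - (r - 1)" using S finS by (simp add: card_Diff_subset)
  then have "k \<le> card ((\<lambda>x. insert x S) ` (W - S))"
    using card_image[OF inj] assms(2,3) by simp
  then have "\<not> (\<lambda>x. insert x S) ` (W - S) \<subseteq> {e \<in> F. v \<in> e}"
    using card_mono[of "{e \<in> F. v \<in> e}" "(\<lambda>x. insert x S) ` (W - S)"] F[of v] S(1) v by fastforce
  then obtain x where x: "x \<in> W - S" "insert x S \<notin> F" using v by auto
  show ?thesis
    by (rule that[of "insert x S"]) (use x S finS assms(2) in auto)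
qed

lemma matching_avoiding:
  assumes "finite U" "r \<ge> 2" "card U \<ge> r * t + k"
    and F: "\<And>v. v \<in> U \<Longrightarrow> finite {e \<in> F. v \<in> e} \<and> card {e \<in> F. v \<in> e} < k"
  shows "\<exists>M. card M = t \<and> finite M \<and> disjoint M \<and> M \<inter> F = {} \<and> (\<forall>e\<in>M. e \<subseteq> U \<and> card e = r)"
  using assms(3)
proof (induction t)
  case 0
  show ?case by (rule exI[of _ "{}"]) auto
next
  case (Suc t)
  then obtain M where M: "card M = t" "finite M" "disjoint M" "M \<inter> F = {}"
    "\<forall>e\<in>M. e \<subseteq> U \<and> card e = r" by auto
  have "card (\<Union>M) = (\<Sum>e\<in>M. card e)"
    by (rule card_Union_disjoint[OF M(3)]) (use M(5) assms(1) in \<open>blast intro: finite_subset\<close>)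
  then have "card (\<Union>M) = r * t" using M(1,5) by simp
  moreover have "card (U - \<Union>M) = card U - card (\<Union>M)"
    using M(5) assms(1) by (intro card_Diff_subset) (auto intro: finite_subset[of "\<Union>M" U])
  ultimately have "card (U - \<Union>M) \<ge> r + k" using Suc.prems by simp
  from edge_avoiding[OF _ assms(2) this, of F] obtain e
    where e: "e \<subseteq> U - \<Union>M" "card e = r" "e \<notin> F" using F assms(1) by auto
  have "e \<noteq> {}" using e(2) assms(2) by auto
  then have "e \<notin> M" using e(1) by blast
  moreover have "disjoint (insert e M)"
    using M(3) e(1) unfolding pairwise_insert disjnt_def by blast
  ultimately show ?case
    using M e by (intro exI[of _ "insert e M"]) auto
qed

text \<open>The matchings are chosen one after the other. A vertex lies in at most one edge of each
  earlier matching, so fewer than \<open>k\<close> edges at any vertex are forbidden.\<close>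

lemma disjoint_matchings:
  fixes U :: "'i \<Rightarrow> 'a set"
  assumes "finite J" "card J \<le> k" "r \<ge> 2"
    and U: "\<And>i. i \<in> J \<Longrightarrow> finite (U i) \<and> card (U i) \<ge> r * t + k"
  shows "\<exists>M. (\<forall>i\<in>J. card (M i) = t \<and> finite (M i) \<and> disjoint (M i) \<and>
      (\<forall>e\<in>M i. e \<subseteq> U i \<and> card e = r)) \<and> (\<forall>i\<in>J. \<forall>j\<in>J. i \<noteq> j \<longrightarrow> M i \<inter> M j = {})"
  using assms(1,2,4)
proof (induction rule: finite_induct)
  case (insert x J)
  from insert obtain M where M:
    "\<forall>i\<in>J. card (M i) = t \<and> finite (M i) \<and> disjoint (M i) \<and> (\<forall>e\<in>M i. e \<subseteq> U i \<and> card e = r)"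
    "\<forall>i\<in>J. \<forall>j\<in>J. i \<noteq> j \<longrightarrow> M i \<inter> M j = {}" by fastforce
  let ?F = "\<Union>i\<in>J. M i"
  have deg: "finite {e \<in> ?F. v \<in> e} \<and> card {e \<in> ?F. v \<in> e} < k" for v
  proof
    show "finite {e \<in> ?F. v \<in> e}" using M(1) insert.hyps(1) by auto
    have one: "card {e \<in> M i. v \<in> e} \<le> 1" if "i \<in> J" for i
    proof -
      have "\<forall>e\<in>M i. \<forall>e'\<in>M i. e \<noteq> e' \<longrightarrow> e \<inter> e' = {}"
        using M(1) that by (auto simp: pairwise_def disjnt_def)
      then have "\<forall>e\<in>{e \<in> M i. v \<in> e}. \<forall>e'\<in>{e \<in> M i. v \<in> e}. e = e'" by blast
      then show ?thesis using M(1) that by (simp add: card_le_Suc0_iff_eq)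
    qed
    have "{e \<in> ?F. v \<in> e} = (\<Union>i\<in>J. {e \<in> M i. v \<in> e})" by auto
    then have "card {e \<in> ?F. v \<in> e} \<le> (\<Sum>i\<in>J. card {e \<in> M i. v \<in> e})"
      using card_UN_le[OF insert.hyps(1), of "\<lambda>i. {e \<in> M i. v \<in> e}"] by simp
    also have "\<dots> \<le> (\<Sum>i\<in>J. 1)" using one by (rule sum_mono)
    also have "\<dots> < k" using insert.hyps insert.prems(1) by simp
    finally show "card {e \<in> ?F. v \<in> e} < k" .
  qed
  obtain N where N: "card N = t" "finite N" "disjoint N" "N \<inter> ?F = {}"
    "\<forall>e\<in>N. e \<subseteq> U x \<and> card e = r"
    using matching_avoiding[OF _ assms(3) _ deg, of "U x" t] insert.prems(2)[of x] by auto
  have NM: "N \<inter> M j = {}" if "j \<in> J" for j using N(4) that by blast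
  let ?M = "M(x := N)"
  have sizes: "card (?M i) = t \<and> finite (?M i) \<and> disjoint (?M i) \<and> (\<forall>e\<in>?M i. e \<subseteq> U i \<and> card e = r)"
    if "i \<in> insert x J" for i
    by (cases "i = x") (use that M(1) N in simp_all)
  have disj: "?M i \<inter> ?M j = {}" if ij: "i \<in> insert x J" "j \<in> insert x J" "i \<noteq> j" for i j
  proof -
    consider "i = x" "j \<in> J" "j \<noteq> x" | "j = x" "i \<in> J" "i \<noteq> x" | "i \<in> J" "j \<in> J" "i \<noteq> x" "j \<noteq> x"
      using ij by blast
    then show ?thesis
      by cases (use NM M(2) ij(3) in \<open>simp_all add: Int_commute\<close>)
  qed
  show ?case
    by (rule exI[of _ ?M], rule conjI) (intro ballI impI sizes disj; assumption)+
qed simp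

section \<open>The lower bound\<close>

text \<open>Recoloring a matching inside the set of vertices that a color does not touch makes each
  matching edge a component of that color: the old edges of the color avoid this set, and the
  recoloring for the other colors can only remove old edges.\<close>

lemma recoloring_le_f_max:
  assumes "k \<ge> 1" "r \<ge> 2" and c: "c \<in> edge_colorings n k r"
    and large: "\<And>i. i \<in> {1..k} \<Longrightarrow> r * t + k \<le> card ({..<n} - \<Union>(color_class n r c i))"
  shows "t \<le> f_max n k r"
proof -
  let ?U = "\<lambda>i. {..<n} - \<Union>(color_class n r c i)"
  have "\<exists>M. (\<forall>i\<in>{1..k}. card (M i) = t \<and> finite (M i) \<and> disjoint (M i) \<and>
      (\<forall>e\<in>M i. e \<subseteq> ?U i \<and> card e = r)) \<and>
      (\<forall>i\<in>{1..k}. \<forall>j\<in>{1..k}. i \<noteq> j \<longrightarrow> M i \<inter> M j = {})"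
    by (rule disjoint_matchings[of "{1..k}" k]) (use assms in auto)
  then obtain M where M0: "(\<forall>i\<in>{1..k}. card (M i) = t \<and> finite (M i) \<and> disjoint (M i) \<and>
      (\<forall>e\<in>M i. e \<subseteq> ?U i \<and> card e = r)) \<and>
      (\<forall>i\<in>{1..k}. \<forall>j\<in>{1..k}. i \<noteq> j \<longrightarrow> M i \<inter> M j = {})" ..
  have M: "\<And>i. i \<in> {1..k} \<Longrightarrow> card (M i) = t \<and> finite (M i) \<and> disjoint (M i)"
    "\<And>i e. i \<in> {1..k} \<Longrightarrow> e \<in> M i \<Longrightarrow> e \<subseteq> ?U i \<and> card e = r"
    "\<And>i j. i \<in> {1..k} \<Longrightarrow> j \<in> {1..k} \<Longrightarrow> i \<noteq> j \<Longrightarrow> M i \<inter> M j = {}"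
    using M0 by blast+
  \<comment> \<open>The matchings are edge-disjoint, so the choice below is between at most one color.\<close>
  define d where "d = (\<lambda>e. if \<exists>i\<in>{1..k}. e \<in> M i then SOME i. i \<in> {1..k} \<and> e \<in> M i else c e)"
  have dM: "d e = i" if "i \<in> {1..k}" "e \<in> M i" for e i
  proof -
    have "d e = (SOME i. i \<in> {1..k} \<and> e \<in> M i)" using that unfolding d_def by auto
    moreover have "(SOME i. i \<in> {1..k} \<and> e \<in> M i) = i"
      by (rule some_equality) (use that M(3) in blast)+
    ultimately show ?thesis by simp
  qed
  have dc: "d e = c e" if "\<And>i. i \<in> {1..k} \<Longrightarrow> e \<notin> M i" for e
    using that unfolding d_def by auto
  have d: "d \<in> edge_colorings n k r"
    unfolding edge_colorings_def
  proof
    fix e assume "e \<in> complete_edges n r"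
    then have "c e \<in> {1..k}" using c unfolding edge_colorings_def by auto
    then show "d e \<in> {1..k}" using dM[of _ e] dc[of e] by metis
  qed
  have "t \<le> f_coloring n k r d"
  proof (rule f_coloring_geI[OF assms(1)])
    fix i assume i: "i \<in> {1..k}"
    let ?H = "color_class n r d i"
    have "M i \<subseteq> edge_components ?H"
    proof
      fix e assume e: "e \<in> M i"
      show "e \<in> edge_components ?H"
      proof (rule isolated_edge_is_component)
        show "e \<in> ?H"
          using M(2)[OF i e] dM[OF i e] unfolding color_class_def complete_edges_def by auto
        show "e \<noteq> {}" using M(2)[OF i e] assms(2) by auto
        fix e' assume e': "e' \<in> ?H" "e' \<inter> e \<noteq> {}"
        show "e' = e"
        proof (cases "\<exists>j\<in>{1..k}. e' \<in> M j")
          case True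
          then have "e' \<in> M i" using dM e'(1) unfolding color_class_def by auto
          then show ?thesis using M(1)[OF i] e e'(2) by (auto simp: pairwise_def disjnt_def)
        next
          case False
          then have "e' \<in> color_class n r c i"
            using dc[of e'] e'(1) unfolding color_class_def by auto
          then show ?thesis using M(2)[OF i e] e'(2) by blast
        qed
      qed
    qed
    then have "card (M i) \<le> card (edge_components ?H)"
      by (rule card_mono[rotated])
        (intro finite_edge_components finite_subset[OF Union_color_class finite_lessThan])
    then show "t \<le> card (edge_components ?H)" using M(1)[OF i] by simp
  qed
  then show ?thesis using f_coloring_le_f_max[OF assms(1) d] by simp
qed

text \<open>The residue classes modulo \<open>N\<close> are the clusters of the blow-up; a cluster has at most
  \<open>n div N + 1\<close> elements below \<open>n\<close>.\<close>

lemma card_mod_preimage_le: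
  fixes n N :: nat
  assumes "finite T"
  shows "card {v. v < n \<and> v mod N \<in> T} \<le> card T * (n div N + 1)"
proof -
  have "card {v. v < n \<and> v mod N \<in> T} \<le> card (T \<times> {..n div N})"
  proof (rule card_inj_on_le)
    show "inj_on (\<lambda>v. (v mod N, v div N)) {v. v < n \<and> v mod N \<in> T}"
      by (auto simp: inj_on_def) (metis div_mult_mod_eq)
    show "(\<lambda>v. (v mod N, v div N)) ` {v. v < n \<and> v mod N \<in> T} \<subseteq> T \<times> {..n div N}"
      by (auto intro: div_le_mono)
  qed (use assms in auto)
  then show ?thesis by (simp add: card_cartesian_product)
qed

text \<open>An edge of the blow-up is projected to its set of clusters, which may have fewer than
  \<open>r\<close> elements and is then enlarged to an arbitrary edge of the original hypergraph. Whatever the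
  choice, a color touches only clusters of vertices that it touched before.\<close>

lemma blow_up_coloring:
  assumes "1 \<le> r" "r \<le> N" and c: "c \<in> edge_colorings N k r"
  obtains d where "d \<in> edge_colorings n k r"
    "\<And>i. card (\<Union>(color_class n r d i)) \<le> card (\<Union>(color_class N r c i)) * (n div N + 1)"
proof -
  have ex: "\<exists>e'. e' \<in> complete_edges N r \<and> (\<lambda>v. v mod N) ` e \<subseteq> e'"
    if "e \<in> complete_edges n r" for e
  proof -
    have e: "card e = r" using that unfolding complete_edges_def by auto
    then have fin: "finite e" using assms(1) card.infinite by fastforce
    have "card ((\<lambda>v. v mod N) ` e) \<le> r" using card_image_le[OF fin] e by metis
    moreover have "(\<lambda>v. v mod N) ` e \<subseteq> {..<N}" using assms(1,2) by auto
    ultimately show ?thesis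
      using exists_subset_between[of "(\<lambda>v. v mod N) ` e" r "{..<N}"] assms(2)
      unfolding complete_edges_def by auto
  qed
  define g where "g = (\<lambda>e. SOME e'. e' \<in> complete_edges N r \<and> (\<lambda>v. v mod N) ` e \<subseteq> e')"
  have g: "g e \<in> complete_edges N r" "(\<lambda>v. v mod N) ` e \<subseteq> g e" if "e \<in> complete_edges n r" for e
    using someI_ex[OF ex[OF that]] unfolding g_def by auto
  show ?thesis
  proof (rule that[of "c \<circ> g"])
    show "c \<circ> g \<in> edge_colorings n k r"
      using c g(1) unfolding edge_colorings_def by auto
    fix i
    have fin: "finite (\<Union>(color_class N r c i))"
      using finite_subset[OF Union_color_class] by blast
    have "\<Union>(color_class n r (c \<circ> g) i) \<subseteq> {v. v < n \<and> v mod N \<in> \<Union>(color_class N r c i)}"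
    proof
      fix v assume "v \<in> \<Union>(color_class n r (c \<circ> g) i)"
      then obtain e where e: "e \<in> complete_edges n r" "c (g e) = i" "v \<in> e"
        unfolding color_class_def by auto
      then have "g e \<in> color_class N r c i" "v mod N \<in> g e"
        using g[OF e(1)] unfolding color_class_def by auto
      then show "v \<in> {v. v < n \<and> v mod N \<in> \<Union>(color_class N r c i)}"
        using e(1,3) unfolding complete_edges_def by auto
    qed
    then have "card (\<Union>(color_class n r (c \<circ> g) i))
        \<le> card {v. v < n \<and> v mod N \<in> \<Union>(color_class N r c i)}"
      by (rule card_mono[rotated]) auto
    also have "\<dots> \<le> card (\<Union>(color_class N r c i)) * (n div N + 1)"
      by (rule card_mod_preimage_le[OF fin])
    finally show "card (\<Union>(color_class n r (c \<circ> g) i))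
        \<le> card (\<Union>(color_class N r c i)) * (n div N + 1)" .
  qed
qed

lemma z_min_attained:
  assumes "k \<ge> 1" "r \<le> n"
  obtains c where "card (c ` complete_edges n r) \<le> k" "z_min k n r = z_coloring n r c"
proof -
  have "z_min k n r \<in> z_coloring n r ` {c. card (c ` complete_edges n r) \<le> k}"
    unfolding z_min_def
    by (rule Min_in) (use assms finite_z_coloring few_color_colorings_nonempty in auto)
  then show ?thesis using that by auto
qed

lemma z_inf_le_1:
  assumes "k \<ge> 1"
  shows "z_inf k r \<le> 1"
proof -
  obtain c where c: "z_min k r r = z_coloring r r c"
    using z_min_attained[OF assms order_refl] by blast
  have "z_inf k r \<le> z_min k r r"
    unfolding z_inf_def by (rule cINF_lower[OF bdd_below_z_min[OF assms]]) auto
  also have "\<dots> \<le> 1"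
    using z_coloring_in[OF order_refl, of r c] unfolding c by (auto simp: divide_le_eq_1)
  finally show ?thesis .
qed

lemma z_inf_nonneg:
  assumes "k \<ge> 1"
  shows "0 \<le> z_inf k r"
  unfolding z_inf_def
proof (rule cINF_greatest)
  fix n assume "n \<in> {r..}"
  then have n: "r \<le> n" by simp
  obtain c where "z_min k n r = z_coloring n r c" using z_min_attained[OF assms n] .
  then show "0 \<le> z_min k n r" using z_coloring_in[OF n, of c] by auto
qed simp

text \<open>Colorings in the definition of \<open>z\<close> use at most \<open>k\<close> arbitrary natural numbers as
  colors; here these are renamed to elements of \<open>{1..k}\<close>.\<close>

lemma near_optimal_coloring:
  assumes "k \<ge> 1" "z_inf k r < w"
  obtains N c where "r \<le> N" "c \<in> edge_colorings N k r"
    "\<And>i. real (card (\<Union>(color_class N r c i))) \<le> w * real N"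
proof -
  have w: "w > 0" using z_inf_nonneg[OF assms(1), of r] assms(2) by linarith
  obtain N where N: "r \<le> N" "z_min k N r < w"
    using assms bdd_below_z_min[OF assms(1), of r] unfolding z_inf_def
    by (subst (asm) cINF_less_iff) auto
  obtain c where c: "card (c ` complete_edges N r) \<le> k" "z_min k N r = z_coloring N r c"
    using z_min_attained[OF assms(1) N(1)] .
  have "card (c ` complete_edges N r) \<le> card {1..k}" using c(1) by simp
  then obtain h where h: "h ` c ` complete_edges N r \<subseteq> {1..k}" "inj_on h (c ` complete_edges N r)"
    using card_le_inj[OF finite_imageI[OF finite_complete_edges] finite_atLeastAtMost] by blast
  show ?thesis
  proof (rule that[of N "h \<circ> c"])
    show "h \<circ> c \<in> edge_colorings N k r"
      using h(1) unfolding edge_colorings_def by auto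
    fix i
    show "real (card (\<Union>(color_class N r (h \<circ> c) i))) \<le> w * real N"
    proof (cases "color_class N r (h \<circ> c) i = {}")
      case True
      then show ?thesis using w by simp
    next
      case False
      then obtain e where e: "e \<in> complete_edges N r" "h (c e) = i"
        unfolding color_class_def by auto
      have "color_class N r (h \<circ> c) i \<subseteq> color_class N r c (c e)"
        using e h(2) unfolding color_class_def inj_on_def by auto
      then have "card (\<Union>(color_class N r (h \<circ> c) i)) \<le> card (\<Union>(color_class N r c (c e)))"
        by (intro card_mono Union_mono finite_subset[OF Union_color_class finite_lessThan])
      moreover have "z_color N r c (c e) \<le> z_coloring N r c"
        unfolding z_coloring_def using e(1) finite_complete_edges by (intro Max_ge) auto
      moreover have "real (card (\<Union>(color_class N r c (c e)))) = z_color N r c (c e) * real N"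
        using card_Union_color_class[of N r c "c e"] unfolding z_color_def by auto
      ultimately show ?thesis
        using N(2) c(2) by (smt (verit) mult_right_mono of_nat_0_le_iff of_nat_mono)
    qed
  qed (rule N(1))
qed

text \<open>A coloring of a fixed number \<open>N\<close> of vertices is blown up to \<open>n\<close> vertices. The errors
  from the uneven clusters, from the greedy choice and from rounding are bounded in terms of
  \<open>N\<close>, \<open>k\<close>, \<open>r\<close>, and are absorbed in half of \<open>\<eta>\<close>; the other half pays for the distance of
  the coloring from the infimum.\<close>

lemma f_max_lower:
  assumes "k \<ge> 1" "r \<ge> 2" "\<eta> > 0"
  shows "\<forall>\<^sub>F n in sequentially. real (f_max n k r) \<ge> real n * ((1 - z_inf k r) / real r - \<eta>)"
proof -
  define w where "w = z_inf k r + real r * \<eta> / 2"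
  have "real r * \<eta> > 0" using assms by simp
  then have w: "z_inf k r < w" "0 \<le> w"
    using z_inf_nonneg[OF assms(1), of r] unfolding w_def by linarith+
  obtain N c where N: "r \<le> N" "c \<in> edge_colorings N k r"
    "\<And>i. real (card (\<Union>(color_class N r c i))) \<le> w * real N"
    using near_optimal_coloring[OF assms(1) w(1)] by metis
  have N0: "N > 0" using N(1) assms(2) by auto
  have "\<forall>\<^sub>F n in sequentially. real n \<ge> ((w * real N + real k) / real r + 1) * 2 / \<eta>"
    by (rule filterlim_real_sequentially[THEN filterlim_at_top[THEN iffD1], rule_format])
  then show ?thesis
  proof eventually_elim
    case (elim n)
    define X where "X = (real n - w * real n - w * real N - real k) / real r"
    define t where "t = nat \<lfloor>X\<rfloor>"
    have "(w * real N + real k) / real r + 1 \<le> real n * \<eta> / 2"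
      using elim assms(3) by (simp add: field_simps)
    moreover have "real n * ((1 - z_inf k r) / real r - \<eta>) =
      X + (w * real N + real k) / real r - real n * \<eta> / 2"
      using assms(2) unfolding X_def w_def by (simp add: field_simps)
    ultimately have 1: "real n * ((1 - z_inf k r) / real r - \<eta>) \<le> X - 1" by linarith
    show ?case
    proof (cases "X < 0")
      case True
      then show ?thesis using 1 by linarith
    next
      case False
      then have t: "real t \<le> X" "X - 1 \<le> real t" unfolding t_def by linarith+
      obtain d where d: "d \<in> edge_colorings n k r"
        "\<And>i. card (\<Union>(color_class n r d i)) \<le> card (\<Union>(color_class N r c i)) * (n div N + 1)"
        using blow_up_coloring[of r N c k n] N assms(2) by auto
      have "t \<le> f_max n k r"
      proof (rule recoloring_le_f_max[OF assms(1,2) d(1)])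
        fix i
        have "real (card (\<Union>(color_class n r d i)))
            \<le> real (card (\<Union>(color_class N r c i)) * (n div N + 1))"
          using d(2) of_nat_mono by blast
        also have "\<dots> = real (card (\<Union>(color_class N r c i))) * (real (n div N) + 1)"
          by (simp add: algebra_simps)
        also have "\<dots> \<le> (w * real N) * (real n / real N + 1)"
          using N(3) w(2) of_nat_div_le_of_nat[where ?'a = real, of n N] by (intro mult_mono) auto
        also have "\<dots> = w * real n + w * real N" using N0 by (simp add: field_simps)
        finally have 2: "real (card (\<Union>(color_class n r d i))) \<le> w * real n + w * real N" .
        have "real r * real t \<le> real r * X" using t(1) by (intro mult_left_mono) auto
        also have "\<dots> = real n - w * real n - w * real N - real k"
          unfolding X_def using assms(2) by simp
        finally have "real (r * t + k) \<le> real n - real (card (\<Union>(color_class n r d i)))"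
          using 2 by simp
        also have "\<dots> = real (n - card (\<Union>(color_class n r d i)))"
          using card_Union_color_class[of n r d i] by (simp add: of_nat_diff)
        also have "n - card (\<Union>(color_class n r d i)) = card ({..<n} - \<Union>(color_class n r d i))"
          using Union_color_class[of n r d i]
          by (subst card_Diff_subset) (auto intro: finite_subset[OF Union_color_class])
        finally show "r * t + k \<le> card ({..<n} - \<Union>(color_class n r d i))"
          by (simp only: of_nat_le_iff)
      qed
      then show ?thesis using t 1 by linarith
    qed
  qed
qed

text \<open>If \<open>z = 1\<close>, the claimed lower bound is zero, and the error term cannot be obtained by
  dividing by it.\<close>

lemma f_max_asymptotic_lower:
  assumes "k \<ge> 1" "r \<ge> 2"
  shows "\<exists>\<delta> :: nat \<Rightarrow> real. \<delta> \<longlonglongrightarrow> 0 \<and> (\<forall>\<^sub>F n in sequentially.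
    real (f_max n k r) \<ge> real n * (1 / real r - z_inf k r / real r) * (1 + \<delta> n))"
proof -
  define a where "a = 1 / real r - z_inf k r / real r"
  have a': "a = (1 - z_inf k r) / real r" unfolding a_def by (simp add: diff_divide_distrib)
  have "a \<ge> 0" unfolding a' using z_inf_le_1[OF assms(1)] by simp
  then consider "a = 0" | "a > 0" by linarith
  then show ?thesis
  proof cases
    case 1
    then show ?thesis unfolding a_def[symmetric] by (intro exI[of _ "\<lambda>_. 0"]) auto
  next
    case 2
    \<comment> \<open>The ratio may stay above \<open>a\<close>; cutting it off makes it converge.\<close>
    define b where "b = (\<lambda>n. min a (real (f_max n k r) / real n))"
    have b: "b \<longlonglongrightarrow> a"
    proof (rule order_tendstoI)
      fix y assume "y < a"
      then have "\<forall>\<^sub>F n in sequentially. real (f_max n k r) \<ge> real n * (a - (a - y) / 2)"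
        using f_max_lower[OF assms, of "(a - y) / 2"] unfolding a' by simp
      then show "\<forall>\<^sub>F n in sequentially. y < b n"
        using eventually_gt_at_top[of 0]
      proof eventually_elim
        case (elim n)
        then have "a - (a - y) / 2 \<le> real (f_max n k r) / real n"
          by (simp add: pos_le_divide_eq mult.commute)
        then show ?case using \<open>y < a\<close> unfolding b_def by (auto simp: field_simps)
      qed
    next
      fix y assume "a < y"
      then show "\<forall>\<^sub>F n in sequentially. b n < y" unfolding b_def by (simp add: min_less_iff_disj)
    qed
    show ?thesis
    proof (intro exI[of _ "\<lambda>n. b n / a - 1"] conjI)
      show "(\<lambda>n. b n / a - 1) \<longlonglongrightarrow> 0"
        using tendsto_diff[OF tendsto_divide[OF b tendsto_const[of a]] tendsto_const[of 1]] 2 by simp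
      show "\<forall>\<^sub>F n in sequentially.
        real (f_max n k r) \<ge> real n * (1 / real r - z_inf k r / real r) * (1 + (b n / a - 1))"
        using eventually_gt_at_top[of 0]
      proof eventually_elim
        case (elim n)
        have "real n * b n \<le> real n * (real (f_max n k r) / real n)"
          unfolding b_def by (intro mult_left_mono) auto
        then show ?case using elim 2 unfolding a_def[symmetric] by simp
      qed
    qed
  qed
qed

section \<open>At most as many colors as the uniformity\<close>

text \<open>An edge containing, for each color, a vertex not touched by that color would itself have
  one of the colors.\<close>

lemma spanning_color:
  assumes "r \<le> n" "card (c ` complete_edges n r) \<le> r"
  obtains s where "s \<in> c ` complete_edges n r" "\<Union>(color_class n r c s) = {..<n}"
proof (rule ccontr)
  assume contra: "\<not> thesis"
  have "\<forall>s\<in>c ` complete_edges n r. \<exists>v\<in>{..<n}. v \<notin> \<Union>(color_class n r c s)"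
  proof
    fix s assume "s \<in> c ` complete_edges n r"
    then have "\<Union>(color_class n r c s) \<noteq> {..<n}" using that[of s] contra by auto
    then show "\<exists>v\<in>{..<n}. v \<notin> \<Union>(color_class n r c s)"
      using Union_color_class[of n r c s] by blast
  qed
  then obtain v where v: "\<And>s. s \<in> c ` complete_edges n r \<Longrightarrow>
      v s \<in> {..<n} \<and> v s \<notin> \<Union>(color_class n r c s)" by metis
  let ?S = "v ` c ` complete_edges n r"
  have "card ?S \<le> r"
    using card_image_le[of "c ` complete_edges n r" v] finite_complete_edges assms(2)
    by (meson finite_imageI le_trans)
  moreover have "?S \<subseteq> {..<n}" using v by auto
  ultimately obtain e where e: "?S \<subseteq> e" "e \<subseteq> {..<n}" "card e = r"
    using exists_subset_between[of ?S r "{..<n}"] assms(1) by auto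
  then have "e \<in> complete_edges n r" unfolding complete_edges_def by auto
  then have "e \<in> color_class n r c (c e)" "v (c e) \<in> e" "v (c e) \<notin> \<Union>(color_class n r c (c e))"
    using e(1) v unfolding color_class_def by auto
  then show False by auto
qed

lemma z_inf_eq_1:
  assumes "k \<ge> 1" "k \<le> r"
  shows "z_inf k r = 1"
proof -
  have "z_min k n r = 1" if n: "r \<le> n" for n
  proof -
    obtain c where c: "card (c ` complete_edges n r) \<le> k" "z_min k n r = z_coloring n r c"
      using z_min_attained[OF assms(1) n] .
    obtain s where s: "s \<in> c ` complete_edges n r" "\<Union>(color_class n r c s) = {..<n}"
      using spanning_color[OF n, of c] c(1) assms(2) by auto
    have "z_color n r c s = 1" using s(2) assms n unfolding z_color_def by simp
    then have "1 \<le> z_coloring n r c"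
      unfolding z_coloring_def using s(1) finite_complete_edges
      by (metis Max_ge finite_imageI imageI)
    moreover have "z_coloring n r c \<le> 1"
      using z_coloring_in[OF n, of c] by (auto simp: divide_le_eq_1)
    ultimately show ?thesis using c(2) by simp
  qed
  then have "z_inf k r = (INF n\<in>{r..}. 1)"
    unfolding z_inf_def by (intro INF_cong) auto
  then show ?thesis by simp
qed

text \<open>A set \<open>A\<close> stands for the bipartition into \<open>A\<close> and its complement.\<close>

definition splits :: "'a set \<Rightarrow> 'a set \<Rightarrow> bool" where
  "splits A S \<longleftrightarrow> S \<inter> A \<noteq> {} \<and> S - A \<noteq> {}"

lemma splits_mono: "splits A S \<Longrightarrow> S \<subseteq> T \<Longrightarrow> splits A T"
  unfolding splits_def by blast

text \<open>If two opposite cells of the common refinement of the two bipartitions are both nonempty,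
  a point from each does. Otherwise each of the two diagonals has an empty cell, which leaves
  two cells at most, and these would lie on the same side of one bipartition.\<close>

lemma two_points_split_two_sets:
  assumes "splits A V" "splits B V"
  obtains u v where "u \<in> V" "v \<in> V" "splits A {u, v}" "splits B {u, v}"
proof (cases "(\<exists>u\<in>V \<inter> A \<inter> B. \<exists>v\<in>V - A - B. True) \<or> (\<exists>u\<in>V \<inter> A - B. \<exists>v\<in>V \<inter> B - A. True)")
  case True
  then show ?thesis using that unfolding splits_def by blast
next
  case False
  then show ?thesis using assms unfolding splits_def by blast
qed

text \<open>A single vertex added to a nonempty set suffices to cross one further bipartition. The
  start with two vertices for two bipartitions is what makes \<open>k\<close> rather than \<open>k + 1\<close> vertices
  suffice, and hence the case \<open>k = r\<close> possible.\<close>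

lemma small_splitting_set:
  assumes "finite F" "\<And>A. A \<in> F \<Longrightarrow> splits A V"
  shows "\<exists>S. finite S \<and> S \<subseteq> V \<and> card S \<le> max 2 (card F) \<and> (\<forall>A\<in>F. splits A S)"
  using assms
proof (induction rule: finite_induct)
  case (insert A F)
  then obtain S where S: "finite S" "S \<subseteq> V" "card S \<le> max 2 (card F)" "\<forall>B\<in>F. splits B S"
    by auto
  consider "F = {}" | B where "F = {B}" | "card F \<ge> 2"
    using insert.hyps(1) by (metis One_nat_def Suc_1 Suc_leI card_0_eq card_1_singletonE le_neq_implies_less less_one not_less)
  then show ?case
  proof cases
    case 1
    then obtain u v where "u \<in> V" "v \<in> V" "splits A {u, v}"
      using two_points_split_two_sets[of A V A] insert.prems by auto
    then show ?thesis using 1 by (intro exI[of _ "{u, v}"]) (auto simp: card_insert_if)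
  next
    case 2
    then obtain u v where "u \<in> V" "v \<in> V" "splits A {u, v}" "splits B {u, v}"
      using two_points_split_two_sets[of A V B] insert.prems by auto
    then show ?thesis using 2 by (intro exI[of _ "{u, v}"]) (auto simp: card_insert_if)
  next
    case 3
    then have "F \<noteq> {}" by auto
    then obtain s where s: "s \<in> S" using S(4) unfolding splits_def by blast
    have "splits A V" using insert.prems by auto
    then obtain v where v: "v \<in> V" "v \<in> A \<longleftrightarrow> s \<notin> A" unfolding splits_def by blast
    then have "splits A (insert v S)" using s unfolding splits_def by auto
    moreover have "card (insert v S) \<le> max 2 (card (insert A F))"
      using S(1,3) insert.hyps 3 by (simp add: card_insert_if)
    moreover have "\<forall>B\<in>F. splits B (insert v S)"
      using S(4) splits_mono by blast
    ultimately show ?thesis using S(1,2) v(1) by (intro exI[of _ "insert v S"]) auto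
  qed
qed (auto intro: exI[of _ "{}"])

lemma two_components_splits:
  assumes "card (edge_components H) \<ge> 2" "\<Union>H \<subseteq> V"
  shows "\<exists>A. splits A V \<and> (\<forall>e\<in>H. \<not> splits A e)"
proof -
  have "\<not> is_singleton (edge_components H)" "edge_components H \<noteq> {}"
    using assms(1) by (auto simp: is_singleton_altdef)
  then obtain C D where CD: "C \<in> edge_components H" "D \<in> edge_components H" "C \<noteq> D"
    by (metis is_singletonI' ex_in_conv)
  have sub: "X \<subseteq> V" "X \<noteq> {}" if "X \<in> edge_components H" for X
    using that Union_edge_components[of H] assms(2)
    by (blast, metis edge_components_contains_edge subset_empty)
  have "C \<inter> D = {}" by (rule edge_components_disjoint[OF CD])
  then have "splits C V" using sub[OF CD(1)] sub[OF CD(2)] unfolding splits_def by blast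
  moreover have "\<not> splits C e" if "e \<in> H" for e
    using edge_subset_component[OF CD(1) that] unfolding splits_def by blast
  ultimately show ?thesis by blast
qed

lemma f_coloring_le_1:
  assumes "k \<ge> 1" "k \<le> r" "r \<ge> 2" "r \<le> n" "c \<in> edge_colorings n k r"
  shows "f_coloring n k r c \<le> 1"
proof (rule ccontr)
  assume "\<not> f_coloring n k r c \<le> 1"
  then have two: "card (edge_components (color_class n r c i)) \<ge> 2" if "i \<in> {1..k}" for i
    using f_coloring_le[OF that, of n r c] by linarith
  have "\<forall>i\<in>{1..k}. \<exists>A. splits A {..<n} \<and> (\<forall>e\<in>color_class n r c i. \<not> splits A e)"
    by (intro ballI two_components_splits two Union_color_class)
  then obtain A where A: "\<And>i. i \<in> {1..k} \<Longrightarrow> splits (A i) {..<n}"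
    "\<And>i e. i \<in> {1..k} \<Longrightarrow> e \<in> color_class n r c i \<Longrightarrow> \<not> splits (A i) e" by metis
  have "\<exists>S. finite S \<and> S \<subseteq> {..<n} \<and> card S \<le> max 2 (card (A ` {1..k})) \<and>
      (\<forall>B\<in>A ` {1..k}. splits B S)"
    by (rule small_splitting_set) (use A(1) in blast)+
  then obtain S where S: "finite S" "S \<subseteq> {..<n}" "card S \<le> max 2 (card (A ` {1..k}))"
    "\<forall>B\<in>A ` {1..k}. splits B S" by (elim exE conjE) (rule that)
  have "card (A ` {1..k}) \<le> k" using card_image_le[of "{1..k}" A] by simp
  then have "card S \<le> r" using S(3) assms by linarith
  then obtain e where e: "S \<subseteq> e" "e \<subseteq> {..<n}" "card e = r"
    using exists_subset_between[of S r "{..<n}"] assms S by auto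
  then have "e \<in> complete_edges n r" unfolding complete_edges_def by auto
  then have "c e \<in> {1..k}" "e \<in> color_class n r c (c e)"
    using assms(5) unfolding edge_colorings_def color_class_def by auto
  then show False using A(2) S(4) e(1) splits_mono by blast
qed

lemma f_max_eq_1:
  assumes "k \<ge> 1" "k \<le> r" "r \<ge> 2" "r \<le> n" "k \<le> n choose r"
  shows "f_max n k r = 1"
proof (rule antisym)
  show "f_max n k r \<le> 1"
    using f_max_attained[OF assms(1), of n r] f_coloring_le_1[OF assms(1-4)] by metis
  obtain E where E: "E \<subseteq> complete_edges n r" "card E = k" "finite E"
    using obtain_subset_with_card_n[of k "complete_edges n r"] assms(5) card_complete_edges by metis
  obtain h where h: "bij_betw h E {1..k}"
    using finite_same_card_bij[of E "{1..k}"] E by auto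
  define c where "c = (\<lambda>e. if e \<in> E then h e else 1)"
  have c: "c \<in> edge_colorings n k r"
    using bij_betwE[OF h] assms(1) unfolding edge_colorings_def c_def by auto
  have "1 \<le> f_coloring n k r c"
  proof (rule f_coloring_geI[OF assms(1)])
    fix i assume "i \<in> {1..k}"
    then have "i \<in> h ` E" using bij_betw_imp_surj_on[OF h] by simp
    then obtain e where e: "e \<in> E" "h e = i" by auto
    then have "e \<in> color_class n r c i" "card e = r"
      using E(1) unfolding color_class_def c_def complete_edges_def by auto
    then have "\<Union>(color_class n r c i) \<noteq> {}" using assms(3) by fastforce
    then have "edge_components (color_class n r c i) \<noteq> {}"
      using Union_edge_components[of "color_class n r c i"] by auto
    moreover have "finite (edge_components (color_class n r c i))"
      by (intro finite_edge_components finite_subset[OF Union_color_class finite_lessThan])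
    ultimately show "1 \<le> card (edge_components (color_class n r c i))"
      by (simp add: Suc_leI card_gt_0_iff)
  qed
  then show "1 \<le> f_max n k r" using f_coloring_le_f_max[OF assms(1) c] by simp
qed

theorem theorem1p3:
  fixes r k :: nat
  assumes "r \<ge> 2" and "k \<ge> 1"
  shows "(k \<ge> r + 1 \<longrightarrow>
            (\<exists>\<epsilon> :: nat \<Rightarrow> real. \<epsilon> \<longlonglongrightarrow> 0 \<and>
               (\<forall>\<^sub>F n in sequentially.
                  real n * (1 / real r - 1 / (real r * root r (real k))) * (1 + \<epsilon> n)
                    \<ge> real (f_max n k r))) \<and>
            (\<exists>\<delta> :: nat \<Rightarrow> real. \<delta> \<longlonglongrightarrow> 0 \<and>
               (\<forall>\<^sub>F n in sequentially.
                  real (f_max n k r)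
                    \<ge> real n * (1 / real r - z_inf k r / real r) * (1 + \<delta> n)))) \<and>
         (k \<le> r \<longrightarrow>
            z_inf k r = 1 \<and>
            (\<forall>n. n \<ge> r \<longrightarrow> k \<le> n choose r \<longrightarrow> f_max n k r = 1))"
  using f_max_asymptotic_upper[of k r] f_max_asymptotic_lower[of k r]
    z_inf_eq_1[of k r] f_max_eq_1[of k r] assms by auto

end
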